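(* Let $k$ be a positive integer. For every integer $n\geqslant\lceil k^2/2+2k+1\rceil$ there exists a $k$-prolific permutation $\sigma\in S_n$.
   Context: $S_n$ is the set of permutations of $[n]$. A permutation $\sigma\in S_n$ contains $\pi\in S_r$ ($\pi\preceq\sigma$) if there are indices $i_1<\dots<i_r$ with $\sigma(i_1)\cdots\sigma(i_r)$ in the same relative order as $\pi$; for $n>k\geqslant1$, $\sigma$ is $k$-prolific if $|\{\pi\in S_{n-k}:\pi\preceq\sigma\}|=\binom{n}{k}$. *)

theory Defs
  imports Complex_Main "HOL-Combinatorics.Permutations"
begin

text \<open>
  The symmetric group on \<open>[n]\<close> is rendered as the functions \<open>\<sigma>\<close> with \<open>\<sigma> permutes {1..n}\<close>.
  These are the identity outside \<open>{1..n}\<close>, so counting such functions counts permutations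
  of \<open>[n]\<close>.
\<close>

text \<open>
  The strictly increasing map \<open>f\<close> lists the indices \<open>i\<^sub>1 < \<dots> < i\<^sub>r\<close> of an occurrence
  of \<open>\<pi>\<close> (of length \<open>r\<close>) in \<open>\<sigma>\<close> (of length \<open>n\<close>).
\<close>

definition contains_pattern ::
  "nat \<Rightarrow> (nat \<Rightarrow> nat) \<Rightarrow> nat \<Rightarrow> (nat \<Rightarrow> nat) \<Rightarrow> bool" where
  "contains_pattern n \<sigma> r \<pi> \<longleftrightarrow>
     (\<exists>f. strict_mono_on {1..r} f \<and> f ` {1..r} \<subseteq> {1..n} \<and>
          (\<forall>i\<in>{1..r}. \<forall>j\<in>{1..r}. \<sigma> (f i) < \<sigma> (f j) \<longleftrightarrow> \<pi> i < \<pi> j))"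

definition prolific :: "nat \<Rightarrow> nat \<Rightarrow> (nat \<Rightarrow> nat) \<Rightarrow> bool" where
  "prolific k n \<sigma> \<longleftrightarrow>
     1 \<le> k \<and> k < n \<and> \<sigma> permutes {1..n} \<and>
     card {\<pi>. \<pi> permutes {1..n - k} \<and> contains_pattern n \<sigma> (n - k) \<pi>} = n choose k"

end

theory Submission
  imports Defs
begin

text \<open>
  If any two points of the graph of \<open>\<sigma>\<close> are at taxicab distance at least \<open>k + 2\<close>, then \<open>\<sigma>\<close> is
  \<open>k\<close>-prolific. Otherwise deleting two different \<open>k\<close>-sets \<open>A\<close> and \<open>B\<close> leaves the same pattern; let
  \<open>\<phi>\<close> be the order isomorphism from the complement of \<open>B\<close> to the complement of \<open>A\<close>. Up to
  symmetry some point moves to the north-east. A monotone fixed point yields \<open>u, v \<in> A\<close> moving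
  north-east such that \<open>u\<close> is the leftmost such point below \<open>\<phi> v\<close> and \<open>v\<close> the lowest such point to
  the left of \<open>\<phi> u\<close>. The horizontal displacement of \<open>u\<close> and the vertical displacement of \<open>v\<close> can each
  be charged to points of \<open>A\<close>, and the points charged twice lie in the box spanned by the two
  displacements. So the half-perimeter of this box is at most \<open>k\<close> plus the number of points of \<open>A\<close> in
  it, which is impossible for points at mutual distance at least \<open>k + 2\<close>.

  With \<open>e = k div 2 + 1\<close>, a permutation of minimal distance \<open>k + 2\<close> is the one whose inverse lists the
  residue classes modulo \<open>2 * e + 1\<close> in the order \<open>e, 0, e + 1, 1, \<dots>, e - 1, 2 * e\<close>, each class in
  decreasing order.
\<close>

section \<open>Ranks\<close>

definition rank :: "('a \<Rightarrow> 'b::linorder) \<Rightarrow> 'a set \<Rightarrow> 'a \<Rightarrow> nat" where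
  "rank K S v = card {x \<in> S. K x \<le> K v}"

lemma rank_cong: "(\<And>x. x \<in> S \<Longrightarrow> K x \<le> K v \<longleftrightarrow> L x \<le> L v) \<Longrightarrow> rank K S v = rank L S v"
  unfolding rank_def by (intro arg_cong[where f = card]) auto

lemma rank_image:
  assumes "inj_on f I"
  shows "rank K (f ` I) (f i) = rank (K \<circ> f) I i"
proof -
  have "{x \<in> f ` I. K x \<le> K (f i)} = f ` {j \<in> I. K (f j) \<le> K (f i)}"
    by auto
  moreover have "inj_on f {j \<in> I. K (f j) \<le> K (f i)}"
    using assms by (rule inj_on_subset) auto
  ultimately show ?thesis
    by (simp add: rank_def card_image)
qed

lemma rank_less_iff:
  assumes "finite S" "v \<in> S" "w \<in> S"
  shows "rank K S v < rank K S w \<longleftrightarrow> K v < K w"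
proof
  assume "K v < K w"
  then have "w \<in> {x \<in> S. K x \<le> K w} - {x \<in> S. K x \<le> K v}"
    using assms by auto
  with \<open>K v < K w\<close> have "{x \<in> S. K x \<le> K v} \<subset> {x \<in> S. K x \<le> K w}"
    by auto
  then show "rank K S v < rank K S w"
    unfolding rank_def using assms by (intro psubset_card_mono) auto
next
  assume "rank K S v < rank K S w"
  moreover have "rank K S w \<le> rank K S v" if "K w \<le> K v"
    unfolding rank_def using assms that by (intro card_mono) auto
  ultimately show "K v < K w"
    by (meson not_le)
qed

lemma bij_betw_rank:
  assumes "finite S" "inj_on K S"
  shows "bij_betw (rank K S) S {1..card S}"
proof -
  have inj: "inj_on (rank K S) S"
  proof (rule inj_onI)
    fix v w assume vw: "v \<in> S" "w \<in> S" "rank K S v = rank K S w"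
    then have "\<not> K v < K w" "\<not> K w < K v"
      using rank_less_iff[OF \<open>finite S\<close>] by (metis less_irrefl)+
    then show "v = w"
      using assms(2) vw by (auto simp: inj_on_def)
  qed
  have "rank K S v \<in> {1..card S}" if "v \<in> S" for v
  proof -
    have "rank K S v \<le> card S"
      unfolding rank_def using assms by (intro card_mono) auto
    moreover have "rank K S v \<noteq> 0"
      using that assms by (auto simp: rank_def card_eq_0_iff)
    ultimately show ?thesis by simp
  qed
  then have "rank K S ` S \<subseteq> {1..card S}" by auto
  then have "rank K S ` S = {1..card S}"
    using inj by (intro card_subset_eq) (simp_all add: card_image)
  with inj show ?thesis by (simp add: bij_betw_def)
qed

lemma rank_eq_self:
  assumes "bij_betw X S {1..n}" "v \<in> S"
  shows "rank X S v = X v"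
proof -
  have "rank X S v = rank id {1..n} (X v)"
    using rank_image[of X S id v] assms(1) by (simp add: bij_betw_def)
  also have "{x \<in> {1..n}. id x \<le> id (X v)} = {1..X v}"
    using bij_betwE[OF assms(1)] assms(2) by auto
  then have "rank id {1..n} (X v) = X v"
    by (simp add: rank_def)
  finally show ?thesis .
qed

section \<open>Taxicab-separated points in a box\<close>

definition taxicab_separated :: "('a \<Rightarrow> nat) \<Rightarrow> ('a \<Rightarrow> nat) \<Rightarrow> nat \<Rightarrow> 'a set \<Rightarrow> bool" where
  "taxicab_separated X Y d S \<longleftrightarrow>
     pairwise (\<lambda>p q. int d \<le> \<bar>int (X p) - int (X q)\<bar> + \<bar>int (Y p) - int (Y q)\<bar>) S"

lemma taxicab_separatedD:
  assumes "taxicab_separated X Y d S" "p \<in> S" "q \<in> S" "p \<noteq> q"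
  shows "int d \<le> \<bar>int (X p) - int (X q)\<bar> + \<bar>int (Y p) - int (Y q)\<bar>"
  using assms by (auto simp: taxicab_separated_def pairwise_def)

lemma taxicab_separated_subset:
  "taxicab_separated X Y d S \<Longrightarrow> T \<subseteq> S \<Longrightarrow> taxicab_separated X Y d T"
  unfolding taxicab_separated_def by (rule pairwise_subset)

lemma card_separated_in_box_le_4:
  assumes sep: "taxicab_separated X Y d S"
    and box: "X ` S \<subseteq> {x..<x + w}" "Y ` S \<subseteq> {y..<y + h}"
    and dims: "w + h < 2 * d"
  shows "card S \<le> 4"
proof -
  define quadrant where "quadrant p = (2 * (X p - x) < w, 2 * (Y p - y) < h)" for p
  have same_half: "2 * \<bar>int a - int b\<bar> \<le> int l"
    if "a \<in> {z..<z + l}" "b \<in> {z..<z + l}" "2 * (a - z) < l \<longleftrightarrow> 2 * (b - z) < l" for a b z l :: nat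
    using that by (cases "2 * (a - z) < l") (auto simp: abs_if)
  have "inj_on quadrant S"
  proof (rule inj_onI, rule ccontr)
    fix p q assume pq: "p \<in> S" "q \<in> S" "quadrant p = quadrant q" "p \<noteq> q"
    have "2 * \<bar>int (X p) - int (X q)\<bar> \<le> int w"
      using box pq by (intro same_half[where z = x]) (auto simp: quadrant_def)
    moreover have "2 * \<bar>int (Y p) - int (Y q)\<bar> \<le> int h"
      using box pq by (intro same_half[where z = y]) (auto simp: quadrant_def)
    ultimately have "2 * int d \<le> int w + int h"
      using taxicab_separatedD[OF sep pq(1,2,4)] by simp
    then show False
      using dims by presburger
  qed
  then have "card S \<le> card (UNIV :: (bool \<times> bool) set)"
    by (metis card_image card_mono finite subset_UNIV)
  then show ?thesis
    by (simp add: card_UNIV_bool flip: UNIV_Times_UNIV)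
qed

lemma separated_pair_in_box:
  assumes sep: "taxicab_separated X Y d S" and "2 \<le> card S"
    and box: "X ` S \<subseteq> {x..<x + w}" "Y ` S \<subseteq> {y..<y + h}"
  shows "d + 2 \<le> w + h"
proof -
  obtain T where "T \<subseteq> S" "card T = 2"
    using obtain_subset_with_card_n[OF \<open>2 \<le> card S\<close>] by auto
  then obtain p q where pq: "p \<in> S" "q \<in> S" "p \<noteq> q"
    by (auto simp: card_2_iff)
  have "X p \<in> {x..<x + w}" "X q \<in> {x..<x + w}" "Y p \<in> {y..<y + h}" "Y q \<in> {y..<y + h}"
    using box pq by auto
  then show ?thesis
    using taxicab_separatedD[OF sep pq] by auto
qed

lemma separated_triple_in_box:
  assumes sep: "taxicab_separated X Y d S" and "3 \<le> card S"
    and box: "X ` S \<subseteq> {x..<x + w}" "Y ` S \<subseteq> {y..<y + h}"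
  shows "3 * d + 4 \<le> 2 * (w + h)"
proof -
  obtain T where "T \<subseteq> S" "card T = 3"
    using obtain_subset_with_card_n[OF \<open>3 \<le> card S\<close>] by auto
  then obtain p q r where "{p, q, r} \<subseteq> S" "p \<noteq> q" "q \<noteq> r" "p \<noteq> r"
    by (auto simp: card_3_iff)
  then have pqr: "p \<in> S" "q \<in> S" "r \<in> S" "p \<noteq> q" "q \<noteq> r" "p \<noteq> r"
    by auto
  have perimeter: "\<bar>int a - int b\<bar> + \<bar>int b - int c\<bar> + \<bar>int a - int c\<bar> + 2 \<le> 2 * int l"
    if "a \<in> {z..<z + l}" "b \<in> {z..<z + l}" "c \<in> {z..<z + l}" for a b c z l :: nat
    using that by (simp add: abs_if)
  have "\<bar>int (X p) - int (X q)\<bar> + \<bar>int (X q) - int (X r)\<bar> + \<bar>int (X p) - int (X r)\<bar> + 2 \<le> 2 * int w"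
    "\<bar>int (Y p) - int (Y q)\<bar> + \<bar>int (Y q) - int (Y r)\<bar> + \<bar>int (Y p) - int (Y r)\<bar> + 2 \<le> 2 * int h"
    using box pqr by (intro perimeter[where z = x] perimeter[where z = y]; auto)+
  then have "3 * int d + 4 \<le> 2 * (int w + int h)"
    using taxicab_separatedD[OF sep pqr(1,2,4)] taxicab_separatedD[OF sep pqr(2,3,5)]
      taxicab_separatedD[OF sep pqr(1,3,6)] by simp
  then show ?thesis by presburger
qed

lemma card_separated_in_box_le_1:
  assumes sep: "taxicab_separated X Y (k + 2) S"
    and box: "X ` S \<subseteq> {x..<x + w}" "Y ` S \<subseteq> {y..<y + h}"
    and dims: "w \<le> k" "h \<le> k" "w + h \<le> k + card S"
  shows "card S \<le> 1"
proof (rule ccontr)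
  assume "\<not> card S \<le> 1"
  then have "k + 4 \<le> w + h"
    using separated_pair_in_box[OF sep _ box] by simp
  then have "3 \<le> card S"
    using dims by simp
  then have "3 * k + 10 \<le> 2 * (w + h)"
    using separated_triple_in_box[OF sep _ box] by simp
  moreover have "card S \<le> 4"
    using card_separated_in_box_le_4[OF sep box] dims by simp
  ultimately show False
    using dims by simp
qed

section \<open>Mutual minima\<close>

lemma finite_monotone_fixed_point:
  fixes K :: "'a \<Rightarrow> 'b::linorder"
  assumes "finite N" "N \<noteq> {}" and K: "inj_on K N" and T: "T \<in> N \<rightarrow> N"
    and mono: "\<And>a b. a \<in> N \<Longrightarrow> b \<in> N \<Longrightarrow> K a \<le> K b \<Longrightarrow> K (T a) \<le> K (T b)"
  obtains v where "v \<in> N" "T v = v"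
proof -
  define D where "D = {a \<in> N. K (T a) \<le> K a}"
  have "Max (K ` N) \<in> K ` N"
    using assms by (intro Max_in) auto
  then obtain m where "m \<in> N" "K m = Max (K ` N)"
    by auto
  moreover have "K (T m) \<le> Max (K ` N)"
    using T \<open>finite N\<close> \<open>m \<in> N\<close> by (intro Max_ge) auto
  ultimately have "m \<in> D"
    by (simp add: D_def)
  define v where "v = arg_min_on K D"
  have "finite D" using \<open>finite N\<close> by (simp add: D_def)
  then have "v \<in> D"
    using \<open>m \<in> D\<close> unfolding v_def by (intro arg_min_if_finite(1)) auto
  then have "T v \<in> D"
    using mono[of "T v" v] T by (auto simp: D_def)
  then have "K v \<le> K (T v)"
    using \<open>finite D\<close> unfolding v_def by (intro arg_min_least) auto
  then have "T v = v"
    using \<open>v \<in> D\<close> T K by (auto simp: D_def inj_on_def)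
  then show thesis
    using that \<open>v \<in> D\<close> by (simp add: D_def)
qed

lemma leftmost_below_function:
  fixes X Y Y' :: "'a \<Rightarrow> nat"
  assumes "finite N" and up: "\<And>a. a \<in> N \<Longrightarrow> Y a < Y' a"
  obtains L where "L \<in> N \<rightarrow> N" "\<forall>v\<in>N. Y (L v) < Y' v"
    "\<forall>v. \<forall>c\<in>N. Y c < Y' v \<longrightarrow> X (L v) \<le> X c"
proof
  define L where "L v = arg_min_on X {c \<in> N. Y c < Y' v}" for v
  have "L v \<in> {c \<in> N. Y c < Y' v}" if "v \<in> N" for v
    using that assms unfolding L_def by (intro arg_min_if_finite(1)) auto
  then show "L \<in> N \<rightarrow> N" "\<forall>v\<in>N. Y (L v) < Y' v"
    by auto
  have "X (L v) \<le> X c" if "c \<in> N" "Y c < Y' v" for v c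
    using that assms unfolding L_def by (intro arg_min_least) auto
  then show "\<forall>v. \<forall>c\<in>N. Y c < Y' v \<longrightarrow> X (L v) \<le> X c"
    by blast
qed

lemma mutual_minima:
  fixes X Y X' Y' :: "'a \<Rightarrow> nat"
  assumes fin: "finite N" "N \<noteq> {}" and inj: "inj_on Y N"
    and right: "\<And>a. a \<in> N \<Longrightarrow> X a < X' a" and up: "\<And>a. a \<in> N \<Longrightarrow> Y a < Y' a"
    and X_mono: "\<And>a b. a \<in> N \<Longrightarrow> b \<in> N \<Longrightarrow> X a \<le> X b \<Longrightarrow> X' a \<le> X' b"
    and Y_mono: "\<And>a b. a \<in> N \<Longrightarrow> b \<in> N \<Longrightarrow> Y a \<le> Y b \<Longrightarrow> Y' a \<le> Y' b"
  obtains u v where "u \<in> N" "v \<in> N" "Y u < Y' v" "X v < X' u"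
    "\<forall>c\<in>N. Y c < Y' v \<longrightarrow> X u \<le> X c" "\<forall>c\<in>N. X c < X' u \<longrightarrow> Y v \<le> Y c"
proof -
  obtain L where L: "L \<in> N \<rightarrow> N" "\<forall>v\<in>N. Y (L v) < Y' v"
      and leftmost: "\<forall>v. \<forall>c\<in>N. Y c < Y' v \<longrightarrow> X (L v) \<le> X c"
    using leftmost_below_function[of N Y Y' X, OF fin(1) up] by blast
  obtain R where R: "R \<in> N \<rightarrow> N" "\<forall>u\<in>N. X (R u) < X' u"
      and lowest: "\<forall>u. \<forall>c\<in>N. X c < X' u \<longrightarrow> Y (R u) \<le> Y c"
    using leftmost_below_function[of N X X' Y, OF fin(1) right] by blast
  have L_antimono: "X (L b) \<le> X (L a)" if "a \<in> N" "b \<in> N" "Y a \<le> Y b" for a b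
    using leftmost L Y_mono[OF that] that by (meson PiE order_less_le_trans)
  have R_antimono: "Y (R b) \<le> Y (R a)" if "a \<in> N" "b \<in> N" "X a \<le> X b" for a b
    using lowest R X_mono[OF that] that by (meson PiE order_less_le_trans)
  obtain v where v: "v \<in> N" "R (L v) = v"
  proof (rule finite_monotone_fixed_point[OF fin inj, of "R \<circ> L"])
    show "R \<circ> L \<in> N \<rightarrow> N"
      using L(1) R(1) by auto
    show "Y ((R \<circ> L) a) \<le> Y ((R \<circ> L) b)" if "a \<in> N" "b \<in> N" "Y a \<le> Y b" for a b
      using R_antimono L_antimono[OF that] L(1) that by auto
  qed auto
  moreover have "L v \<in> N"
    using L(1) v(1) by auto
  moreover have "X v < X' (L v)" "\<forall>c\<in>N. X c < X' (L v) \<longrightarrow> Y v \<le> Y c"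
    using R(2) lowest v(2) \<open>L v \<in> N\<close> by metis+
  ultimately show thesis
    using L(2) leftmost that by blast
qed

section \<open>Order isomorphisms between complements\<close>

locale deletion_isomorphism =
  fixes V A B :: "'a set" and \<phi> :: "'a \<Rightarrow> 'a" and n :: nat and X :: "'a \<Rightarrow> nat"
  assumes coordinate: "bij_betw X V {1..n}"
    and A_subset: "A \<subseteq> V" and B_subset: "B \<subseteq> V"
    and survivors: "bij_betw \<phi> (V - B) (V - A)"
    and order_preserving: "\<And>p q. p \<in> V - B \<Longrightarrow> q \<in> V - B \<Longrightarrow> X p < X q \<Longrightarrow> X (\<phi> p) < X (\<phi> q)"
begin

lemma finite_V: "finite V"
  using coordinate bij_betw_finite by blast

lemma finite_A: "finite A" and finite_B: "finite B"
  using finite_V A_subset B_subset finite_subset by blast+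

lemma coordinate_eq_iff: "p \<in> V \<Longrightarrow> q \<in> V \<Longrightarrow> X p = X q \<longleftrightarrow> p = q"
  using coordinate by (auto simp: bij_betw_def inj_on_def)

lemma image_survivor: "p \<in> V - B \<Longrightarrow> \<phi> p \<in> V - A"
  using survivors by (rule bij_betw_apply)

lemma image_less_iff:
  assumes "p \<in> V - B" "q \<in> V - B"
  shows "X (\<phi> p) < X (\<phi> q) \<longleftrightarrow> X p < X q"
  using order_preserving[OF assms] order_preserving[OF assms(2,1)] coordinate_eq_iff[of p q] assms
  by (cases "X p" "X q" rule: linorder_cases) auto

lemma deletion_isomorphism_inverse: "deletion_isomorphism V B A (the_inv_into (V - B) \<phi>) n X"
proof
  let ?\<psi> = "the_inv_into (V - B) \<phi>"
  show inv: "bij_betw ?\<psi> (V - A) (V - B)"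
    using survivors by (rule bij_betw_the_inv_into)
  show "X (?\<psi> p) < X (?\<psi> q)" if "p \<in> V - A" "q \<in> V - A" "X p < X q" for p q
    using image_less_iff[of "?\<psi> p" "?\<psi> q"] bij_betw_apply[OF inv]
      f_the_inv_into_f_bij_betw[OF survivors] that by simp
qed (fact coordinate A_subset B_subset)+

lemma deletion_isomorphism_reflect: "deletion_isomorphism V A B \<phi> n (\<lambda>p. n + 1 - X p)"
proof
  have "bij_betw (\<lambda>x. n + 1 - x) {1..n} {1..n}"
    by (rule bij_betwI[where g = "\<lambda>x. n + 1 - x"]) auto
  then show "bij_betw (\<lambda>p. n + 1 - X p) V {1..n}"
    using bij_betw_trans[OF coordinate] by (simp add: comp_def)
  show "n + 1 - X (\<phi> p) < n + 1 - X (\<phi> q)"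
    if "p \<in> V - B" "q \<in> V - B" "n + 1 - X p < n + 1 - X q" for p q
  proof -
    have "X (\<phi> q) < X (\<phi> p)"
      using that order_preserving[of q p] by auto
    moreover have "X (\<phi> p) \<in> {1..n}"
      using image_survivor[OF that(1)] bij_betw_apply[OF coordinate] by blast
    ultimately show ?thesis by auto
  qed
qed (fact survivors A_subset B_subset)+

lemma rank_image_survivor:
  assumes "p \<in> V - B"
  shows "rank X (V - A) (\<phi> p) = rank X (V - B) p"
proof -
  have "rank X (V - A) (\<phi> p) = rank (X \<circ> \<phi>) (V - B) p"
    using rank_image[of \<phi> "V - B"] survivors by (simp add: bij_betw_def)
  also have "\<dots> = rank X (V - B) p"
    using image_less_iff assms by (intro rank_cong) (simp flip: not_less)
  finally show ?thesis .
qed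

lemma rank_plus_deleted:
  assumes "D \<subseteq> V" "p \<in> V"
  shows "rank X (V - D) p + card {a \<in> D. X a \<le> X p} = X p"
proof -
  have "{v \<in> V. X v \<le> X p} = {v \<in> V - D. X v \<le> X p} \<union> {a \<in> D. X a \<le> X p}"
    using assms by auto
  moreover have "{v \<in> V - D. X v \<le> X p} \<inter> {a \<in> D. X a \<le> X p} = {}"
    by auto
  ultimately have "rank X V p = rank X (V - D) p + card {a \<in> D. X a \<le> X p}"
    unfolding rank_def using finite_V finite_subset[OF assms(1)] by (simp add: card_Un_disjoint)
  then show ?thesis
    using rank_eq_self[OF coordinate assms(2)] by simp
qed

lemma displacement_eq:
  assumes "u \<in> V - B"
  shows "X (\<phi> u) + card {b \<in> B. X b \<le> X u} = X u + card {a \<in> A. X a \<le> X (\<phi> u)}"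
  using rank_plus_deleted[OF A_subset, of "\<phi> u"] rank_plus_deleted[OF B_subset, of u]
    rank_image_survivor[OF assms] image_survivor[OF assms] assms by auto

text \<open>\<open>\<phi>\<close> maps the left movers up to \<open>t\<close> to left movers or into \<open>B\<close>, and it never meets \<open>A\<close>.\<close>

lemma card_left_movers_le:
  "card {a \<in> A - B. X (\<phi> a) < X a \<and> X a \<le> t} \<le> card {b \<in> B - A. X b \<le> t}"
proof -
  define W where "W = {p \<in> V - B. X (\<phi> p) < X p \<and> X p \<le> t}"
  let ?B = "{b \<in> B - A. X b \<le> t}"
  have "finite W" using finite_V by (simp add: W_def)
  have "\<phi> ` W \<subseteq> (W - A) \<union> ?B"
    using image_survivor order_preserving by (auto simp: W_def)
  then have "card (\<phi> ` W) \<le> card ((W - A) \<union> ?B)"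
    using \<open>finite W\<close> finite_B by (intro card_mono) auto
  also have "\<dots> \<le> card (W - A) + card ?B"
    by (rule card_Un_le)
  finally have "card W \<le> card (W - A) + card ?B"
    using survivors by (subst (asm) card_image) (auto simp: bij_betw_def inj_on_def W_def)
  then have "card (W \<inter> A) \<le> card ?B"
    using card_Int_Diff[OF \<open>finite W\<close>, of A] by simp
  also have "W \<inter> A = {a \<in> A - B. X (\<phi> a) < X a \<and> X a \<le> t}"
    using A_subset by (auto simp: W_def)
  finally show ?thesis .
qed

text \<open>
  In \<open>displacement_eq\<close> the points of \<open>A \<inter> B\<close> up to \<open>u\<close> cancel, and the left movers in \<open>A - B\<close> are
  outnumbered by points of \<open>B - A\<close>. The other points of \<open>A\<close> pay for the displacement of \<open>u\<close>.
\<close>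

definition charged :: "'a \<Rightarrow> 'a set" where
  "charged u = {a \<in> A. X a < X (\<phi> u) \<and> (if a \<in> B then X u < X a else X a < X (\<phi> a))}"

lemma finite_charged: "finite (charged u)"
  using finite_A by (simp add: charged_def)

lemma deleted_up_to_image_subset:
  assumes u: "u \<in> V - B" "X u < X (\<phi> u)"
  shows "{a \<in> A. X a \<le> X (\<phi> u)} \<subseteq>
    charged u \<union> ({a \<in> A \<inter> B. X a \<le> X u} \<union> {a \<in> A - B. X (\<phi> a) < X a \<and> X a \<le> X u})"
proof
  fix a assume a: "a \<in> {a \<in> A. X a \<le> X (\<phi> u)}"
  then have "a \<in> A" "a \<in> V" using A_subset by auto
  moreover have "\<phi> u \<in> V" "\<phi> u \<notin> A"
    using image_survivor[OF u(1)] by simp_all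
  ultimately have "X a \<noteq> X (\<phi> u)"
    by (metis coordinate_eq_iff)
  with a have below: "X a < X (\<phi> u)"
    by simp
  show "a \<in> charged u \<union> ({a \<in> A \<inter> B. X a \<le> X u} \<union> {a \<in> A - B. X (\<phi> a) < X a \<and> X a \<le> X u})"
  proof (cases "a \<in> B \<or> X a < X (\<phi> a)")
    case True
    then show ?thesis
      using \<open>a \<in> A\<close> below by (auto simp: charged_def)
  next
    case False
    then have "a \<in> V - B" using \<open>a \<in> V\<close> by simp
    then have "\<phi> a \<in> V" "\<phi> a \<notin> A"
      using image_survivor by simp_all
    then have "X a \<noteq> X (\<phi> a)"
      using \<open>a \<in> A\<close> \<open>a \<in> V\<close> by (metis coordinate_eq_iff)
    moreover have "\<not> X u < X a"
      using order_preserving[OF u(1) \<open>a \<in> V - B\<close>] below False by auto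
    ultimately show ?thesis
      using False \<open>a \<in> A\<close> by auto
  qed
qed

lemma displacement_le_card_charged:
  assumes u: "u \<in> V - B" "X u < X (\<phi> u)"
  shows "X (\<phi> u) \<le> X u + card (charged u)"
proof -
  let ?C = "{a \<in> A \<inter> B. X a \<le> X u}" and ?L = "{a \<in> A - B. X (\<phi> a) < X a \<and> X a \<le> X u}"
  have "card {a \<in> A. X a \<le> X (\<phi> u)} \<le> card (charged u \<union> (?C \<union> ?L))"
    using deleted_up_to_image_subset[OF u] finite_A finite_charged by (intro card_mono) auto
  also have "\<dots> \<le> card (charged u) + (card ?C + card ?L)"
    by (intro order_trans[OF card_Un_le] add_left_mono card_Un_le)
  also have "\<dots> \<le> card (charged u) + (card ?C + card {b \<in> B - A. X b \<le> X u})"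
    using card_left_movers_le by (intro add_left_mono)
  also have "card ?C + card {b \<in> B - A. X b \<le> X u} = card {b \<in> B. X b \<le> X u}"
    using card_Int_Diff[of "{b \<in> B. X b \<le> X u}" A] finite_B
    by (simp add: Int_def set_diff_eq conj_commute conj_left_commute)
  finally show ?thesis
    using displacement_eq[OF u(1)] by simp
qed

end

locale separated_deletion =
  x: deletion_isomorphism V A B \<phi> n X + y: deletion_isomorphism V A B \<phi> n Y
  for V A B :: "'a set" and \<phi> n X Y +
  fixes k :: nat
  assumes card_A: "card A = k" and separated: "taxicab_separated X Y (k + 2) V"
begin

lemma separated_deletion_inverse: "separated_deletion V B A (the_inv_into (V - B) \<phi>) n X Y k"
proof -
  have "card (V - B) = card (V - A)"
    using x.survivors by (rule bij_betw_same_card)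
  then have "card B = card A"
    using x.finite_V x.A_subset x.B_subset
    by (metis card_Diff_subset card_mono diff_diff_cancel finite_subset)
  then show ?thesis
    using card_A separated x.deletion_isomorphism_inverse y.deletion_isomorphism_inverse
    by (simp add: separated_deletion_def separated_deletion_axioms_def)
qed

lemma separated_deletion_reflect: "separated_deletion V A B \<phi> n X (\<lambda>p. n + 1 - Y p) k"
proof -
  have "Y p \<le> n" if "p \<in> V" for p
    using bij_betw_apply[OF y.coordinate that] by simp
  then have "\<bar>int (n + 1 - Y p) - int (n + 1 - Y q)\<bar> = \<bar>int (Y p) - int (Y q)\<bar>"
    if "p \<in> V" "q \<in> V" for p q
    using that by (simp add: of_nat_diff abs_minus_commute le_SucI)
  then have "taxicab_separated X (\<lambda>p. n + 1 - Y p) (k + 2) V"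
    using separated by (auto simp: taxicab_separated_def pairwise_def)
  then show ?thesis
    using card_A x.deletion_isomorphism_axioms y.deletion_isomorphism_reflect
    by (simp add: separated_deletion_def separated_deletion_axioms_def)
qed

definition northeast_movers :: "'a set" where
  "northeast_movers = {p \<in> V - B. X p < X (\<phi> p) \<and> Y p < Y (\<phi> p)}"

lemma northeast_movers_meet_A:
  assumes "northeast_movers \<noteq> {}"
  shows "northeast_movers \<inter> A \<noteq> {}"
proof
  define m where "m = arg_min_on X northeast_movers"
  have fin: "finite northeast_movers"
    using x.finite_V by (simp add: northeast_movers_def)
  have m: "m \<in> northeast_movers"
    unfolding m_def by (rule arg_min_if_finite(1)[OF fin assms])
  assume "northeast_movers \<inter> A = {}"
  with m have "m \<in> V - A"
    by (auto simp: northeast_movers_def)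
  then obtain p where p: "p \<in> V - B" "m = \<phi> p"
    using x.survivors unfolding bij_betw_def by blast
  have "X p < X (\<phi> p)" "Y p < Y (\<phi> p)"
    using m p x.image_less_iff[OF p(1), of m] y.image_less_iff[OF p(1), of m]
    by (auto simp: northeast_movers_def)
  then have "p \<in> northeast_movers"
    using p by (simp add: northeast_movers_def)
  then have "X m \<le> X p"
    unfolding m_def by (intro arg_min_least[OF fin assms])
  with \<open>X p < X (\<phi> p)\<close> p(2) show False
    by simp
qed

lemma displacement_sum_le:
  assumes "u \<in> northeast_movers" "v \<in> northeast_movers"
  shows "X (\<phi> u) - X u \<le> k" "Y (\<phi> v) - Y v \<le> k"
    "X (\<phi> u) - X u + (Y (\<phi> v) - Y v) \<le> k + card (x.charged u \<inter> y.charged v)"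
proof -
  have X: "X (\<phi> u) - X u \<le> card (x.charged u)" and Y: "Y (\<phi> v) - Y v \<le> card (y.charged v)"
    using x.displacement_le_card_charged[of u] y.displacement_le_card_charged[of v] assms
    by (auto simp: northeast_movers_def)
  have "x.charged u \<subseteq> A" "y.charged v \<subseteq> A"
    by (auto simp: x.charged_def y.charged_def)
  then have "card (x.charged u) \<le> k" "card (y.charged v) \<le> k" "card (x.charged u \<union> y.charged v) \<le> k"
    using card_mono[OF x.finite_A] card_A by (metis Un_least)+
  moreover have "card (x.charged u) + card (y.charged v) =
      card (x.charged u \<union> y.charged v) + card (x.charged u \<inter> y.charged v)"
    by (rule card_Un_Int[OF x.finite_charged y.finite_charged])
  ultimately show "X (\<phi> u) - X u \<le> k" "Y (\<phi> v) - Y v \<le> k"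
    "X (\<phi> u) - X u + (Y (\<phi> v) - Y v) \<le> k + card (x.charged u \<inter> y.charged v)"
    using X Y by linarith+
qed

lemma mutually_minimal_northeast_movers:
  assumes "northeast_movers \<noteq> {}"
  obtains u v where "u \<in> northeast_movers \<inter> A" "v \<in> northeast_movers \<inter> A"
    "Y u < Y (\<phi> v)" "X v < X (\<phi> u)"
    "\<forall>c\<in>northeast_movers \<inter> A. Y c < Y (\<phi> v) \<longrightarrow> X u \<le> X c"
    "\<forall>c\<in>northeast_movers \<inter> A. X c < X (\<phi> u) \<longrightarrow> Y v \<le> Y c"
proof (rule mutual_minima)
  let ?N = "northeast_movers \<inter> A"
  show "finite ?N" "?N \<noteq> {}"
    using x.finite_A northeast_movers_meet_A[OF assms] by auto
  show "inj_on Y ?N"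
    using y.coordinate_eq_iff by (auto simp: inj_on_def northeast_movers_def)
  show "X a < X (\<phi> a)" "Y a < Y (\<phi> a)" if "a \<in> ?N" for a
    using that by (auto simp: northeast_movers_def)
  show "X (\<phi> a) \<le> X (\<phi> b)" if "a \<in> ?N" "b \<in> ?N" "X a \<le> X b" for a b
    using that x.image_less_iff[of b a] by (auto simp: northeast_movers_def simp flip: not_less)
  show "Y (\<phi> a) \<le> Y (\<phi> b)" if "a \<in> ?N" "b \<in> ?N" "Y a \<le> Y b" for a b
    using that y.image_less_iff[of b a] by (auto simp: northeast_movers_def simp flip: not_less)
qed (rule that)

lemma charged_twice_in_box:
  assumes p: "p \<in> x.charged u \<inter> y.charged v"
    and u_leftmost: "\<forall>c\<in>northeast_movers \<inter> A. Y c < Y (\<phi> v) \<longrightarrow> X u \<le> X c"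
    and v_lowest: "\<forall>c\<in>northeast_movers \<inter> A. X c < X (\<phi> u) \<longrightarrow> Y v \<le> Y c"
  shows "X p \<in> {X u..<X (\<phi> u)}" "Y p \<in> {Y v..<Y (\<phi> v)}"
proof -
  have "X u \<le> X p \<and> Y v \<le> Y p"
  proof (cases "p \<in> B")
    case True
    then show ?thesis
      using p by (auto simp: x.charged_def y.charged_def)
  next
    case False
    then have "p \<in> northeast_movers \<inter> A"
      using p x.A_subset by (auto simp: x.charged_def y.charged_def northeast_movers_def)
    then show ?thesis
      using p u_leftmost v_lowest by (auto simp: x.charged_def y.charged_def)
  qed
  then show "X p \<in> {X u..<X (\<phi> u)}" "Y p \<in> {Y v..<Y (\<phi> v)}"
    using p by (auto simp: x.charged_def y.charged_def)
qed

lemma no_northeast_movers: "northeast_movers = {}"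
proof (rule ccontr)
  assume "northeast_movers \<noteq> {}"
  then obtain u v where u: "u \<in> northeast_movers \<inter> A" and v: "v \<in> northeast_movers \<inter> A"
    and uv: "Y u < Y (\<phi> v)" "X v < X (\<phi> u)"
    and extremal: "\<forall>c\<in>northeast_movers \<inter> A. Y c < Y (\<phi> v) \<longrightarrow> X u \<le> X c"
      "\<forall>c\<in>northeast_movers \<inter> A. X c < X (\<phi> u) \<longrightarrow> Y v \<le> Y c"
    by (rule mutually_minimal_northeast_movers)
  let ?S = "x.charged u \<inter> y.charged v"
  let ?w = "X (\<phi> u) - X u" and ?h = "Y (\<phi> v) - Y v"
  have dims: "?w \<le> k" "?h \<le> k" "?w + ?h \<le> k + card ?S"
    using displacement_sum_le u v by blast+
  have box: "X ` ?S \<subseteq> {X u..<X u + ?w}" "Y ` ?S \<subseteq> {Y v..<Y v + ?h}"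
    using charged_twice_in_box[OF _ extremal] u v by (auto simp: northeast_movers_def)
  have "?S \<subseteq> V"
    using x.A_subset by (auto simp: x.charged_def)
  then have "card ?S \<le> 1"
    using card_separated_in_box_le_1[OF taxicab_separated_subset[OF separated] box dims] by simp
  moreover have "u \<in> ?S" "v \<in> ?S"
    using u v uv by (auto simp: x.charged_def y.charged_def northeast_movers_def)
  moreover have "finite ?S"
    using x.finite_charged by simp
  ultimately have "u = v"
    by (metis One_nat_def card_le_Suc0_iff_eq)
  have "u \<in> V" "\<phi> u \<in> V" "u \<noteq> \<phi> u"
    using u x.image_survivor by (auto simp: northeast_movers_def)
  then have "int (k + 2) \<le> \<bar>int (X u) - int (X (\<phi> u))\<bar> + \<bar>int (Y u) - int (Y (\<phi> u))\<bar>"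
    by (rule taxicab_separatedD[OF separated])
  then have "k + 2 \<le> ?w + ?h"
    using \<open>u = v\<close> u by (auto simp: northeast_movers_def)
  then show False
    using dims \<open>card ?S \<le> 1\<close> by simp
qed

lemma not_northeast: "p \<in> V - B \<Longrightarrow> X p < X (\<phi> p) \<Longrightarrow> \<not> Y p < Y (\<phi> p)"
  using no_northeast_movers by (auto simp: northeast_movers_def)

lemma not_southeast:
  assumes "p \<in> V - B" "X p < X (\<phi> p)"
  shows "\<not> Y (\<phi> p) < Y p"
  using separated_deletion.not_northeast[OF separated_deletion_reflect assms]
    bij_betw_apply[OF y.coordinate, of p] assms by auto

lemma survivor_not_moved_right:
  assumes "p \<in> V - B"
  shows "\<not> X p < X (\<phi> p)"
  using not_northeast[OF assms] not_southeast[OF assms] y.coordinate_eq_iff[of p "\<phi> p"]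
    x.image_survivor[OF assms] assms by (metis DiffD1 linorder_neqE_nat less_irrefl)

lemma survivor_fixed:
  assumes "p \<in> V - B"
  shows "\<phi> p = p"
proof -
  have "\<not> X (\<phi> p) < X p"
    using separated_deletion.survivor_not_moved_right[OF separated_deletion_inverse, of "\<phi> p"]
      x.image_survivor[OF assms] the_inv_into_f_f[OF bij_betw_imp_inj_on[OF x.survivors] assms]
    by simp
  then have "X (\<phi> p) = X p"
    using survivor_not_moved_right[OF assms] by simp
  then show ?thesis
    using x.coordinate_eq_iff x.image_survivor[OF assms] assms by blast
qed

end

lemma separated_order_isomorphism_fixed:
  assumes X: "bij_betw X V {1..n}" and Y: "bij_betw Y V {1..n}"
    and sep: "taxicab_separated X Y (k + 2) V"
    and ST: "S \<subseteq> V" "T \<subseteq> V" and card: "card S + k = n" and \<phi>: "bij_betw \<phi> T S"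
    and X_mono: "\<And>p q. p \<in> T \<Longrightarrow> q \<in> T \<Longrightarrow> X p < X q \<Longrightarrow> X (\<phi> p) < X (\<phi> q)"
    and Y_mono: "\<And>p q. p \<in> T \<Longrightarrow> q \<in> T \<Longrightarrow> Y p < Y q \<Longrightarrow> Y (\<phi> p) < Y (\<phi> q)"
    and p: "p \<in> T"
  shows "\<phi> p = p"
proof -
  have survivors: "V - (V - S) = S" "V - (V - T) = T"
    using ST by auto
  have "card V = n" "finite V"
    using bij_betw_same_card[OF X] bij_betw_finite[OF X] by simp_all
  then have "card (V - S) = k"
    using card_Diff_subset[of S V] finite_subset[OF ST(1)] ST(1) card by simp
  moreover have "deletion_isomorphism V (V - S) (V - T) \<phi> n X"
    unfolding deletion_isomorphism_def survivors using X \<phi> X_mono by blast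
  moreover have "deletion_isomorphism V (V - S) (V - T) \<phi> n Y"
    unfolding deletion_isomorphism_def survivors using Y \<phi> Y_mono by blast
  ultimately have "separated_deletion V (V - S) (V - T) \<phi> n X Y k"
    unfolding separated_deletion_def separated_deletion_axioms_def using sep by blast
  then show ?thesis
    using separated_deletion.survivor_fixed[of V "V - S" "V - T" \<phi> n X Y k p] p
    by (simp only: survivors)
qed

section \<open>Separated permutations are prolific\<close>

definition pattern_at :: "(nat \<Rightarrow> nat) \<Rightarrow> nat \<Rightarrow> (nat \<Rightarrow> nat) \<Rightarrow> nat set \<Rightarrow> bool" where
  "pattern_at \<sigma> r \<pi> S \<longleftrightarrow> (\<exists>f. strict_mono_on {1..r} f \<and> f ` {1..r} = S \<and>
     (\<forall>i\<in>{1..r}. \<forall>j\<in>{1..r}. \<sigma> (f i) < \<sigma> (f j) \<longleftrightarrow> \<pi> i < \<pi> j))"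

lemma contains_pattern_iff_pattern_at:
  "contains_pattern n \<sigma> r \<pi> \<longleftrightarrow> (\<exists>S\<subseteq>{1..n}. pattern_at \<sigma> r \<pi> S)"
  unfolding contains_pattern_def pattern_at_def by blast

lemma pattern_at_card:
  assumes "pattern_at \<sigma> r \<pi> S"
  shows "card S = r"
proof -
  obtain f where f: "strict_mono_on {1..r} f" "f ` {1..r} = S"
    using assms by (auto simp: pattern_at_def)
  then show ?thesis
    using card_image[OF strict_mono_on_imp_inj_on[OF f(1)]] by simp
qed

lemma strict_mono_on_same_image_eq:
  fixes f g :: "nat \<Rightarrow> nat"
  assumes f: "strict_mono_on {1..r} f" and g: "strict_mono_on {1..r} g"
    and image: "f ` {1..r} = g ` {1..r}" and i: "i \<in> {1..r}"
  shows "f i = g i"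
proof -
  let ?S = "f ` {1..r}"
  have rank: "rank id (h ` {1..r}) (h i) = i" if "strict_mono_on {1..r} h" for h :: "nat \<Rightarrow> nat"
  proof -
    have "rank id (h ` {1..r}) (h i) = rank (id \<circ> h) {1..r} i"
      by (rule rank_image[OF strict_mono_on_imp_inj_on[OF that]])
    also have "\<dots> = rank id {1..r} i"
      using strict_mono_on_less_eq[OF that _ i] by (intro rank_cong) simp
    also have "\<dots> = i"
      using rank_eq_self[of id "{1..r}" r i] i by simp
    finally show ?thesis .
  qed
  have "rank id ?S (f i) = rank id ?S (g i)"
    using rank[OF f] rank[OF g] image by simp
  moreover have "f i \<in> ?S" "g i \<in> ?S"
    using i image by auto
  moreover have "inj_on (rank id ?S) ?S"
    using bij_betw_rank[of ?S id] by (simp add: bij_betw_def)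
  ultimately show ?thesis
    by (meson inj_onD)
qed

lemma permutes_order_isomorphic_eq:
  fixes \<pi> \<rho> :: "nat \<Rightarrow> nat"
  assumes \<pi>: "\<pi> permutes {1..r}" and \<rho>: "\<rho> permutes {1..r}"
    and iso: "\<And>i j. i \<in> {1..r} \<Longrightarrow> j \<in> {1..r} \<Longrightarrow> \<pi> i < \<pi> j \<longleftrightarrow> \<rho> i < \<rho> j"
  shows "\<pi> = \<rho>"
proof
  fix i
  show "\<pi> i = \<rho> i"
  proof (cases "i \<in> {1..r}")
    case True
    then have "rank \<pi> {1..r} i = rank \<rho> {1..r} i"
      using iso by (intro rank_cong) (simp flip: not_less)
    then show ?thesis
      using rank_eq_self[OF permutes_imp_bij[OF \<pi>] True] rank_eq_self[OF permutes_imp_bij[OF \<rho>] True]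
      by simp
  next
    case False
    then show ?thesis
      using permutes_not_in \<pi> \<rho> by metis
  qed
qed

lemma pattern_at_unique:
  assumes "\<pi> permutes {1..r}" "\<rho> permutes {1..r}" and "pattern_at \<sigma> r \<pi> S" "pattern_at \<sigma> r \<rho> S"
  shows "\<pi> = \<rho>"
proof -
  obtain f where f: "strict_mono_on {1..r} f" "f ` {1..r} = S"
    "\<forall>i\<in>{1..r}. \<forall>j\<in>{1..r}. \<sigma> (f i) < \<sigma> (f j) \<longleftrightarrow> \<pi> i < \<pi> j"
    using assms(3) by (auto simp: pattern_at_def)
  obtain g where g: "strict_mono_on {1..r} g" "g ` {1..r} = S"
    "\<forall>i\<in>{1..r}. \<forall>j\<in>{1..r}. \<sigma> (g i) < \<sigma> (g j) \<longleftrightarrow> \<rho> i < \<rho> j"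
    using assms(4) by (auto simp: pattern_at_def)
  have "f i = g i" if "i \<in> {1..r}" for i
    using strict_mono_on_same_image_eq[OF f(1) g(1) _ that] f(2) g(2) by simp
  then show ?thesis
    using f(3) g(3) assms(1,2) by (intro permutes_order_isomorphic_eq) auto
qed

lemma ex_pattern_at:
  assumes \<sigma>: "inj_on \<sigma> S" and "finite S"
  shows "\<exists>\<pi>. \<pi> permutes {1..card S} \<and> pattern_at \<sigma> (card S) \<pi> S"
proof -
  let ?I = "{1..card S}"
  have rank: "bij_betw (rank id S) S ?I"
    using \<open>finite S\<close> inj_on_id by (rule bij_betw_rank)
  define f where "f = the_inv_into S (rank id S)"
  have f: "bij_betw f ?I S"
    unfolding f_def using rank by (rule bij_betw_the_inv_into)
  have rank_f: "rank id S (f i) = i" if "i \<in> ?I" for i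
    unfolding f_def using rank that by (rule f_the_inv_into_f_bij_betw)
  have "strict_mono_on ?I f"
  proof (rule strict_mono_onI)
    fix i j assume ij: "i \<in> ?I" "j \<in> ?I" "i < j"
    then have "rank id S (f i) < rank id S (f j)"
      by (simp only: rank_f)
    then show "f i < f j"
      using rank_less_iff[OF \<open>finite S\<close>] bij_betw_apply[OF f] ij by (metis id_apply)
  qed
  let ?\<pi> = "restrict_id (rank (\<sigma> \<circ> f) ?I) ?I"
  have "inj_on (\<sigma> \<circ> f) ?I"
    using f \<sigma> by (simp add: bij_betw_def comp_inj_on)
  then have "bij_betw (rank (\<sigma> \<circ> f) ?I) ?I ?I"
    using bij_betw_rank[of ?I] by simp
  then have "?\<pi> permutes ?I"
    by (rule permutes_restrict_id)
  moreover have "\<sigma> (f i) < \<sigma> (f j) \<longleftrightarrow> ?\<pi> i < ?\<pi> j" if "i \<in> ?I" "j \<in> ?I" for i j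
    using rank_less_iff[of ?I i j "\<sigma> \<circ> f"] that by simp
  then have "pattern_at \<sigma> (card S) ?\<pi> S"
    unfolding pattern_at_def using \<open>strict_mono_on ?I f\<close> f by (auto simp: bij_betw_def)
  ultimately show ?thesis by blast
qed

lemma separated_pattern_at_unique:
  assumes \<sigma>: "\<sigma> permutes {1..n}" and sep: "taxicab_separated id \<sigma> (k + 2) {1..n}" and n: "n = r + k"
    and S: "S \<subseteq> {1..n}" "pattern_at \<sigma> r \<pi> S" and T: "T \<subseteq> {1..n}" "pattern_at \<sigma> r \<pi> T"
  shows "S = T"
proof -
  let ?I = "{1..r}"
  obtain f where f: "strict_mono_on ?I f" "f ` ?I = S"
    "\<forall>i\<in>?I. \<forall>j\<in>?I. \<sigma> (f i) < \<sigma> (f j) \<longleftrightarrow> \<pi> i < \<pi> j"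
    using S(2) by (auto simp: pattern_at_def)
  obtain g where g: "strict_mono_on ?I g" "g ` ?I = T"
    "\<forall>i\<in>?I. \<forall>j\<in>?I. \<sigma> (g i) < \<sigma> (g j) \<longleftrightarrow> \<pi> i < \<pi> j"
    using T(2) by (auto simp: pattern_at_def)
  have f_bij: "bij_betw f ?I S" and g_bij: "bij_betw g ?I T"
    using f g strict_mono_on_imp_inj_on by (auto simp: bij_betw_def)
  define \<phi> where "\<phi> = f \<circ> the_inv_into ?I g"
  have \<phi>_g: "\<phi> (g i) = f i" if "i \<in> ?I" for i
    using the_inv_into_f_f[OF bij_betw_imp_inj_on[OF g_bij] that] by (simp add: \<phi>_def)
  have \<phi>: "bij_betw \<phi> T S"
    unfolding \<phi>_def using bij_betw_trans[OF bij_betw_the_inv_into[OF g_bij] f_bij] .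
  have "\<phi> p = p" if "p \<in> T" for p
  proof (rule separated_order_isomorphism_fixed[OF _ _ sep S(1) T(1) _ \<phi> _ _ that])
    show "bij_betw \<sigma> {1..n} {1..n}"
      using \<sigma> by (rule permutes_imp_bij)
    show "card S + k = n"
      using pattern_at_card[OF S(2)] n by simp
    show "id (\<phi> p) < id (\<phi> q)" if "p \<in> T" "q \<in> T" "id p < id q" for p q
      using that strict_mono_on_less[OF f(1)] strict_mono_on_less[OF g(1)] g(2) \<phi>_g by auto
    show "\<sigma> (\<phi> p) < \<sigma> (\<phi> q)" if "p \<in> T" "q \<in> T" "\<sigma> p < \<sigma> q" for p q
      using that f(3) g(2,3) \<phi>_g by auto
  qed simp
  then have "\<phi> ` T = T"
    by simp
  then show "S = T"
    using \<phi> by (simp add: bij_betw_def)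
qed

lemma card_contained_patterns:
  assumes \<sigma>: "inj_on \<sigma> {1..n}"
    and unique: "\<And>\<pi> S T. S \<subseteq> {1..n} \<Longrightarrow> T \<subseteq> {1..n} \<Longrightarrow>
      pattern_at \<sigma> r \<pi> S \<Longrightarrow> pattern_at \<sigma> r \<pi> T \<Longrightarrow> S = T"
  shows "card {\<pi>. \<pi> permutes {1..r} \<and> contains_pattern n \<sigma> r \<pi>} = n choose r"
    (is "card ?P = _")
proof -
  let ?Q = "{S. S \<subseteq> {1..n} \<and> card S = r}"
  have "\<exists>\<pi>. \<pi> permutes {1..r} \<and> pattern_at \<sigma> r \<pi> S" if "S \<in> ?Q" for S
    using ex_pattern_at[of \<sigma> S] inj_on_subset[OF \<sigma>] that finite_subset[of S "{1..n}"] by auto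
  then obtain pattern where pattern:
      "\<And>S. S \<in> ?Q \<Longrightarrow> pattern S permutes {1..r} \<and> pattern_at \<sigma> r (pattern S) S"
    by metis
  have "inj_on pattern ?Q"
  proof (rule inj_onI)
    fix S T assume ST: "S \<in> ?Q" "T \<in> ?Q" "pattern S = pattern T"
    then show "S = T"
      using unique[of S T "pattern S"] pattern[of S] pattern[of T] by simp
  qed
  moreover have "pattern ` ?Q = ?P"
  proof
    show "pattern ` ?Q \<subseteq> ?P"
      using pattern contains_pattern_iff_pattern_at by blast
    show "?P \<subseteq> pattern ` ?Q"
    proof
      fix \<pi> assume "\<pi> \<in> ?P"
      then obtain S where S: "S \<subseteq> {1..n}" "pattern_at \<sigma> r \<pi> S" and \<pi>: "\<pi> permutes {1..r}"
        by (auto simp: contains_pattern_iff_pattern_at)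
      then have "S \<in> ?Q" by (simp add: pattern_at_card)
      then show "\<pi> \<in> pattern ` ?Q"
        using pattern_at_unique[OF \<pi> _ S(2)] pattern[of S] by blast
    qed
  qed
  ultimately have "card ?P = card ?Q"
    using card_image[of pattern ?Q] by simp
  then show ?thesis
    using n_subsets[of "{1..n}" r] by simp
qed

lemma separated_imp_prolific:
  assumes k: "1 \<le> k" "k < n" and \<sigma>: "\<sigma> permutes {1..n}"
    and sep: "taxicab_separated id \<sigma> (k + 2) {1..n}"
  shows "prolific k n \<sigma>"
proof -
  have n: "n = (n - k) + k" using k by simp
  have "card {\<pi>. \<pi> permutes {1..n - k} \<and> contains_pattern n \<sigma> (n - k) \<pi>} = n choose (n - k)"
    using permutes_inj_on[OF \<sigma>] separated_pattern_at_unique[OF \<sigma> sep n]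
    by (intro card_contained_patterns) auto
  also have "\<dots> = n choose k"
    using k binomial_symmetric[of k n] by simp
  finally show ?thesis
    using k \<sigma> by (simp add: prolific_def)
qed

section \<open>A separated permutation of every admissible length\<close>

lemma permutation_with_graph:
  assumes X: "bij_betw X V {1..n}" and Y: "bij_betw Y V {1..n}" and sep: "taxicab_separated X Y d V"
  obtains \<sigma> where "\<sigma> permutes {1..n}" "taxicab_separated id \<sigma> d {1..n}"
proof
  define \<sigma> where "\<sigma> = restrict_id (Y \<circ> the_inv_into V X) {1..n}"
  show "\<sigma> permutes {1..n}"
    unfolding \<sigma>_def using bij_betw_trans[OF bij_betw_the_inv_into[OF X] Y]
    by (rule permutes_restrict_id)
  have graph: "\<sigma> (X p) = Y p" if "p \<in> V" for p
    using that bij_betw_apply[OF X that] the_inv_into_f_f[OF bij_betw_imp_inj_on[OF X]]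
    by (simp add: \<sigma>_def)
  have "{1..n} = X ` V"
    using X by (simp add: bij_betw_def)
  then show "taxicab_separated id \<sigma> d {1..n}"
    using sep by (auto simp: taxicab_separated_def pairwise_def graph)
qed

text \<open>
  The points are listed from bottom to top in \<open>2 * e + 1\<close> runs. The columns of run \<open>s\<close> decrease and
  are, counted from \<open>0\<close>, the numbers congruent to \<open>residue e s\<close> modulo \<open>2 * e + 1\<close>; the cell \<open>(s, i)\<close> is
  the \<open>i\<close>-th smallest of them. Passing to the next run changes the residue by \<open>- e\<close> or \<open>e + 1\<close>.
\<close>

definition residue :: "nat \<Rightarrow> nat \<Rightarrow> nat" where
  "residue e s = (if even s then e + s div 2 else s div 2)"

lemma residue_le: "s \<le> 2 * e \<Longrightarrow> residue e s \<le> 2 * e"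
  by (auto simp: residue_def)

lemma bij_betw_residue: "bij_betw (residue e) {..2 * e} {..2 * e}"
  by (rule bij_betwI[where g = "\<lambda>c. if c < e then 2 * c + 1 else 2 * (c - e)"])
    (auto simp: residue_def elim!: oddE)

definition run_length :: "nat \<Rightarrow> nat \<Rightarrow> nat \<Rightarrow> nat" where
  "run_length n e s = (n + 2 * e - residue e s) div (2 * e + 1)"

lemma less_run_length_iff:
  assumes "s \<le> 2 * e"
  shows "i < run_length n e s \<longleftrightarrow> residue e s + i * (2 * e + 1) < n"
proof -
  have "i < run_length n e s \<longleftrightarrow> i + 1 \<le> (n + 2 * e - residue e s) div (2 * e + 1)"
    by (simp add: run_length_def Suc_le_eq)
  also have "\<dots> \<longleftrightarrow> (i + 1) * (2 * e + 1) \<le> n + 2 * e - residue e s"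
    by (rule less_eq_div_iff_mult_less_eq) simp
  also have "\<dots> \<longleftrightarrow> residue e s + i * (2 * e + 1) < n"
    using residue_le[OF assms] by (auto simp: algebra_simps)
  finally show ?thesis .
qed

definition cells :: "nat \<Rightarrow> nat \<Rightarrow> (nat \<times> nat) set" where
  "cells n e = (SIGMA s:{..2 * e}. {..<run_length n e s})"

definition column :: "nat \<Rightarrow> nat \<times> nat \<Rightarrow> nat" where
  "column e = (\<lambda>(s, i). residue e s + i * (2 * e + 1) + 1)"

definition row :: "nat \<Rightarrow> nat \<Rightarrow> nat \<times> nat \<Rightarrow> nat" where
  "row n e = (\<lambda>(s, i). (\<Sum>r<s. run_length n e r) + (run_length n e s - i))"

lemma inj_on_column: "inj_on (column e) (cells n e)"
proof (rule inj_onI)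
  let ?m = "2 * e + 1"
  have residue: "(residue e s + i * ?m) mod ?m = residue e s" "(residue e s + i * ?m) div ?m = i"
    if "s \<le> 2 * e" for s i
    using residue_le[OF that] by (simp_all add: less_Suc_eq_le del: mult_Suc_right)
  fix p q assume "p \<in> cells n e" "q \<in> cells n e" and eq: "column e p = column e q"
  then obtain s i t j where pq: "p = (s, i)" "q = (t, j)" and st: "s \<le> 2 * e" "t \<le> 2 * e"
    by (auto simp: cells_def)
  have "residue e s + i * ?m = residue e t + j * ?m"
    using eq by (simp add: column_def pq)
  then have "residue e s = residue e t" "i = j"
    using residue[OF st(1), of i] residue[OF st(2), of j] by simp_all
  then show "p = q"
    using bij_betw_residue st pq by (auto simp: bij_betw_def inj_on_def)
qed

lemma column_image: "column e ` cells n e = {1..n}"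
proof
  let ?m = "2 * e + 1"
  show "column e ` cells n e \<subseteq> {1..n}"
    using less_run_length_iff by (fastforce simp: cells_def column_def)
  show "{1..n} \<subseteq> column e ` cells n e"
  proof
    fix x assume x: "x \<in> {1..n}"
    have "(x - 1) mod ?m \<in> residue e ` {..2 * e}"
      using bij_betw_residue[of e] mod_less_divisor[of ?m "x - 1"] by (simp add: bij_betw_def)
    then obtain s where s: "s \<le> 2 * e" "residue e s = (x - 1) mod ?m"
      by auto
    then have "residue e s + (x - 1) div ?m * ?m = x - 1"
      by (simp only: mod_div_mult_eq)
    then have "column e (s, (x - 1) div ?m) = x" "(s, (x - 1) div ?m) \<in> cells n e"
      using x s(1) by (auto simp: column_def cells_def less_run_length_iff)
    then show "x \<in> column e ` cells n e"
      by force
  qed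
qed

lemma bij_betw_column: "bij_betw (column e) (cells n e) {1..n}"
  by (simp add: bij_betw_def inj_on_column column_image)

lemma row_in_run:
  assumes "(s, i) \<in> cells n e"
  shows "row n e (s, i) \<in> {(\<Sum>r<s. run_length n e r)<..(\<Sum>r<Suc s. run_length n e r)}"
  using assms by (auto simp: row_def cells_def)

lemma row_less_if_run_less:
  assumes "(s, i) \<in> cells n e" "(t, j) \<in> cells n e" "s < t"
  shows "row n e (s, i) < row n e (t, j)"
proof -
  have "row n e (s, i) \<le> (\<Sum>r<Suc s. run_length n e r)"
    using row_in_run[OF assms(1)] by simp
  also have "\<dots> \<le> (\<Sum>r<t. run_length n e r)"
    using \<open>s < t\<close> by (intro sum_mono2) auto
  also have "\<dots> < row n e (t, j)"
    using row_in_run[OF assms(2)] by simp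
  finally show ?thesis .
qed

lemma bij_betw_row: "bij_betw (row n e) (cells n e) {1..n}"
proof -
  have inj: "inj_on (row n e) (cells n e)"
  proof (rule inj_onI)
    fix p q assume pq: "p \<in> cells n e" "q \<in> cells n e" and eq: "row n e p = row n e q"
    obtain s i t j where [simp]: "p = (s, i)" "q = (t, j)"
      by (cases p, cases q)
    have "s = t"
      using row_less_if_run_less[of s i n e t j] row_less_if_run_less[of t j n e s i] pq eq
      by (cases s t rule: linorder_cases) auto
    then show "p = q"
      using pq eq by (auto simp: row_def cells_def)
  qed
  have card: "card (cells n e) = n"
    using bij_betw_same_card[OF bij_betw_column, of n e] by simp
  have "row n e p \<in> {1..n}" if "p \<in> cells n e" for p
  proof -
    obtain s i where p: "p = (s, i)" and s: "s \<le> 2 * e"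
      using \<open>p \<in> cells n e\<close> by (auto simp: cells_def)
    have "(\<Sum>r<Suc s. run_length n e r) \<le> (\<Sum>r\<le>2 * e. run_length n e r)"
      using s by (intro sum_mono2) auto
    also have "\<dots> = n"
      using card by (simp add: cells_def)
    finally show ?thesis
      using row_in_run that unfolding p by fastforce
  qed
  then have "row n e ` cells n e \<subseteq> {1..n}"
    by auto
  then have "row n e ` cells n e = {1..n}"
    using card inj by (intro card_subset_eq) (simp_all add: card_image)
  with inj show ?thesis
    by (simp add: bij_betw_def)
qed

lemma run_length_ge:
  assumes n: "(2 * e + 1) * l + e \<le> n" and "s \<le> 2 * e"
  shows "l + s mod 2 \<le> run_length n e s"
proof -
  have "(l + s mod 2) * (2 * e + 1) \<le> n + 2 * e - residue e s"
  proof (cases "even s")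
    case True
    then show ?thesis
      using n residue_le[OF assms(2)] by (simp add: residue_def algebra_simps)
  next
    case False
    then have "residue e s + 1 \<le> e"
      using assms(2) by (auto simp: residue_def elim!: oddE)
    then show ?thesis
      using n False by (simp add: odd_iff_mod_2_eq_one algebra_simps)
  qed
  then show ?thesis
    by (simp add: run_length_def less_eq_div_iff_mult_less_eq)
qed

lemma abs_arith_progression_ge:
  fixes a b x m :: int
  assumes "0 \<le> m" "b \<le> \<bar>a\<bar>" "b - a \<le> m" "a + b \<le> m + 2"
  shows "b + x \<le> \<bar>a + x * (m + 1)\<bar>"
proof -
  consider "x = 0" | "1 \<le> x" | "x \<le> - 1" by linarith
  then show ?thesis
  proof cases
    case 2
    then have "m \<le> x * m"
      using mult_right_mono[OF 2 \<open>0 \<le> m\<close>] by simp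
    then show ?thesis
      using assms(3) by (simp add: algebra_simps)
  next
    case 3
    then have "x * m \<le> - m"
      using mult_right_mono[OF 3 \<open>0 \<le> m\<close>] by simp
    then show ?thesis
      using assms(4) 3 by (simp add: algebra_simps)
  qed (use assms(2) in simp)
qed

lemma row_diff:
  assumes "(s, i) \<in> cells n e" "(t, j) \<in> cells n e" "s < t"
  shows "int (row n e (t, j)) - int (row n e (s, i)) =
    int (\<Sum>r\<in>{s<..t}. run_length n e r) - (int j - int i)"
proof -
  have split: "{..<Suc t} = {..<Suc s} \<union> {s<..t}"
    using \<open>s < t\<close> by auto
  have "(\<Sum>r<Suc t. run_length n e r) =
      (\<Sum>r<Suc s. run_length n e r) + (\<Sum>r\<in>{s<..t}. run_length n e r)"
    unfolding split by (intro sum.union_disjoint) auto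
  then show ?thesis
    using assms by (auto simp: row_def cells_def of_nat_diff)
qed

lemma run_length_consecutive_ge:
  assumes "(2 * e + 1) * l + e \<le> n" and "Suc s \<le> 2 * e"
  shows "2 * l + 1 \<le> run_length n e s + run_length n e (Suc s)"
proof -
  have "s mod 2 + Suc s mod 2 = 1" by presburger
  then show ?thesis
    using run_length_ge[OF assms(1), of s] run_length_ge[OF assms] assms(2) by linarith
qed

lemma residue_diff_bounds:
  assumes "s < t" "t \<le> s + 2"
  shows "- int e \<le> int (residue e t) - int (residue e s)"
    "int (residue e t) - int (residue e s) \<le> int e + 1"
proof -
  have "t = s + 1 \<or> t = s + 2" using assms by linarith
  then show "- int e \<le> int (residue e t) - int (residue e s)"
    "int (residue e t) - int (residue e s) \<le> int e + 1"
    by (auto simp: residue_def elim!: oddE)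
qed

lemma sum_run_length_near_ge:
  assumes n: "(2 * e + 1) * l + e \<le> n" and l: "e \<le> l + 1"
    and st: "s < t" "t \<le> s + 2" "t \<le> 2 * e"
  shows "int (e + l + 1) \<le>
    int (\<Sum>r\<in>{s<..t}. run_length n e r) + \<bar>int (residue e t) - int (residue e s)\<bar>"
proof -
  consider "t = s + 1" | "t = s + 2"
    using st(1,2) by linarith
  then show ?thesis
  proof cases
    case 1
    then have "{s<..t} = {t}"
      by auto
    then have "l + t mod 2 \<le> (\<Sum>r\<in>{s<..t}. run_length n e r)"
      using run_length_ge[OF n st(3)] by simp
    moreover have "int (e + 1) \<le> int (t mod 2) + \<bar>int (residue e t) - int (residue e s)\<bar>"
    proof (cases "even s")
      case True
      then have "t mod 2 = 1" using 1 by presburger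
      with True 1 show ?thesis by (simp add: residue_def)
    next
      case False
      with 1 show ?thesis by (auto simp: residue_def elim!: oddE)
    qed
    ultimately show ?thesis by linarith
  next
    case 2
    then have "{s<..t} = {Suc s, Suc (Suc s)}"
      by auto
    then have "2 * l + 1 \<le> (\<Sum>r\<in>{s<..t}. run_length n e r)"
      using run_length_consecutive_ge[OF n, of "Suc s"] 2 st(3) by simp
    moreover have "int (residue e t) - int (residue e s) = 1"
      using 2 by (auto simp: residue_def)
    ultimately show ?thesis
      using l by linarith
  qed
qed

lemma sum_run_length_far_ge:
  assumes n: "(2 * e + 1) * l + e \<le> n" and l: "e \<le> l + 1"
    and t: "s + 3 \<le> t" "t \<le> 2 * e" "1 \<le> run_length n e t"
  shows "e + l + 1 \<le> (\<Sum>r\<in>{s<..t}. run_length n e r)"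
proof -
  have "(\<Sum>r\<in>{Suc s, Suc (Suc s), t}. run_length n e r) \<le> (\<Sum>r\<in>{s<..t}. run_length n e r)"
    using t(1) by (intro sum_mono2) auto
  then show ?thesis
    using run_length_consecutive_ge[OF n, of "Suc s"] t l by simp
qed

lemma separated_in_run:
  assumes "(s, i) \<in> cells n e" "(s, j) \<in> cells n e" "i \<noteq> j"
  shows "2 * int e + 2 \<le> \<bar>int (column e (s, i)) - int (column e (s, j))\<bar> +
    \<bar>int (row n e (s, i)) - int (row n e (s, j))\<bar>"
proof -
  have apart: "1 \<le> \<bar>int i - int j\<bar>"
    using assms(3) by simp
  have "int (column e (s, i)) - int (column e (s, j)) = (int i - int j) * (2 * int e + 1)"
    by (simp add: column_def algebra_simps)
  then have "\<bar>int (column e (s, i)) - int (column e (s, j))\<bar> = \<bar>int i - int j\<bar> * (2 * int e + 1)"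
    by (simp only: abs_mult)
  also have "\<dots> \<ge> 1 * (2 * int e + 1)"
    using apart by (rule mult_right_mono) simp
  finally have "2 * int e + 1 \<le> \<bar>int (column e (s, i)) - int (column e (s, j))\<bar>"
    by simp
  moreover have "int (row n e (s, i)) - int (row n e (s, j)) = int j - int i"
    using assms by (auto simp: row_def cells_def of_nat_diff)
  ultimately show ?thesis
    using apart by linarith
qed

lemma separated_across_runs:
  assumes n: "(2 * e + 1) * l + e \<le> n" and l: "e \<le> l + 1"
    and si: "(s, i) \<in> cells n e" and tj: "(t, j) \<in> cells n e" and "s < t"
  shows "int (e + l + 1) \<le> \<bar>int (column e (t, j)) - int (column e (s, i))\<bar> +
    \<bar>int (row n e (t, j)) - int (row n e (s, i))\<bar>"
proof -
  define x where "x = int j - int i"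
  define a where "a = int (residue e t) - int (residue e s)"
  have t: "t \<le> 2 * e" "1 \<le> run_length n e t"
    using tj by (auto simp: cells_def)
  obtain b where "int (e + l + 1) - b \<le> int (\<Sum>r\<in>{s<..t}. run_length n e r)"
      and b: "b \<le> \<bar>a\<bar>" "b - a \<le> 2 * int e" "a + b \<le> 2 * int e + 2"
  proof (cases "t \<le> s + 2")
    case True
    show thesis
    proof (rule that[of "\<bar>a\<bar>"])
      show "int (e + l + 1) - \<bar>a\<bar> \<le> int (\<Sum>r\<in>{s<..t}. run_length n e r)"
        using sum_run_length_near_ge[OF n l \<open>s < t\<close> True t(1)] unfolding a_def by linarith
    qed (use residue_diff_bounds[OF \<open>s < t\<close> True, of e] in \<open>auto simp: a_def\<close>)
  next
    case False
    then have "s + 3 \<le> t" by simp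
    show thesis
    proof (rule that[of 0])
      show "int (e + l + 1) - 0 \<le> int (\<Sum>r\<in>{s<..t}. run_length n e r)"
        using sum_run_length_far_ge[OF n l \<open>s + 3 \<le> t\<close> t] by (simp only: diff_zero of_nat_le_iff)
    qed (use residue_le[of s e] residue_le[OF t(1)] \<open>s < t\<close> t(1) in \<open>auto simp: a_def\<close>)
  qed
  then have "int (e + l + 1) - b - x \<le> int (row n e (t, j)) - int (row n e (s, i))"
    unfolding row_diff[OF si tj \<open>s < t\<close>] x_def by linarith
  moreover have "int (column e (t, j)) - int (column e (s, i)) = a + x * (2 * int e + 1)"
    by (simp add: column_def a_def x_def algebra_simps)
  moreover have "b + x \<le> \<bar>a + x * (2 * int e + 1)\<bar>"
    using b by (intro abs_arith_progression_ge) auto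
  ultimately show ?thesis by linarith
qed

lemma cells_separated:
  assumes n: "(2 * e + 1) * l + e \<le> n" and l: "e \<le> l + 1" "l \<le> e + 1"
  shows "taxicab_separated (column e) (row n e) (e + l + 1) (cells n e)"
  unfolding taxicab_separated_def
proof (rule pairwiseI)
  fix p q assume pq: "p \<in> cells n e" "q \<in> cells n e" "p \<noteq> q"
  obtain s i t j where st: "p = (s, i)" "q = (t, j)"
    by (cases p, cases q)
  consider "s < t" | "t < s" | "s = t" "i \<noteq> j"
    using pq(3) st by fastforce
  then show "int (e + l + 1) \<le>
    \<bar>int (column e p) - int (column e q)\<bar> + \<bar>int (row n e p) - int (row n e q)\<bar>"
  proof cases
    case 1
    then show ?thesis
      using separated_across_runs[OF n l(1) pq(1,2)[unfolded st] 1] unfolding st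
      by (simp only: abs_minus_commute)
  next
    case 2
    then show ?thesis
      using separated_across_runs[OF n l(1) pq(2,1)[unfolded st] 2] unfolding st by simp
  next
    case 3
    then show ?thesis
      using separated_in_run[of s i n e j] pq l(2) unfolding st by simp
  qed
qed

lemma exists_separated_permutation:
  assumes "(2 * e + 1) * l + e \<le> n" "e \<le> l + 1" "l \<le> e + 1"
  obtains \<sigma> where "\<sigma> permutes {1..n}" "taxicab_separated id \<sigma> (e + l + 1) {1..n}"
  using permutation_with_graph[OF bij_betw_column bij_betw_row cells_separated[OF assms]] by blast

lemma construction_fits:
  fixes k n :: nat
  assumes "int n \<ge> \<lceil>(real k)\<^sup>2 / 2 + 2 * real k + 1\<rceil>"
  shows "(2 * (k div 2 + 1) + 1) * ((k + 1) div 2) + (k div 2 + 1) \<le> n"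
proof -
  have "(real k)\<^sup>2 / 2 + 2 * real k + 1 \<le> real n"
    using assms unfolding ceiling_le_iff by simp
  then have "real (k * k + 4 * k + 2) \<le> real (2 * n)"
    by (simp add: power2_eq_square field_simps)
  then have bound: "k * k + 4 * k + 2 \<le> 2 * n"
    by (simp only: of_nat_le_iff)
  show ?thesis
  proof (cases "even k")
    case True
    then show ?thesis
      using bound by (auto simp: algebra_simps elim!: evenE)
  next
    case False
    then show ?thesis
      using bound by (auto simp: algebra_simps elim!: oddE)
  qed
qed

theorem theorem4p5:
  fixes k n :: nat
  assumes "k \<ge> 1"
    and "int n \<ge> \<lceil>(real k)\<^sup>2 / 2 + 2 * real k + 1\<rceil>"
  shows "\<exists>\<sigma>. \<sigma> permutes {1..n} \<and> prolific k n \<sigma>"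
proof -
  let ?e = "k div 2 + 1" and ?l = "(k + 1) div 2"
  have fits: "(2 * ?e + 1) * ?l + ?e \<le> n"
    using assms(2) by (rule construction_fits)
  have "?e \<le> ?l + 1" "?l \<le> ?e + 1" and distance: "?e + ?l + 1 = k + 2"
    by simp_all
  then obtain \<sigma> where \<sigma>: "\<sigma> permutes {1..n}" "taxicab_separated id \<sigma> (k + 2) {1..n}"
    using exists_separated_permutation[OF fits] unfolding distance by blast
  have "?e + ?l \<le> (2 * ?e + 1) * ?l + ?e"
    by simp
  then have "k < n"
    using fits distance by linarith
  then have "prolific k n \<sigma>"
    using \<sigma> assms(1) by (intro separated_imp_prolific)
  with \<sigma>(1) show ?thesis
    by blast
qed

end
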